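(* Let $W\in\mathbb{R}^{n\times n}$ be a symmetric matrix with $\|W\|<1$, let $a\in\mathbb{R}^n$, let $q(x)=Wx+a$, and let $m\in\{1,2,\dots\}$. If either $m\ge 2$ or $\lambda_{\max}(W)\ne-\lambda_{\min}(W)$, then the $r$-linear convergence factor of AA(m) applied to $q$ is strictly smaller than $\|W\|$, which is the $r$-linear convergence factor of the fixed-point iteration $x^{(k+1)}=q(x^{(k)})$. If on the other hand $m=1$ and $\lambda_{\max}(W)=-\lambda_{\min}(W)$, then the $r$-linear convergence factor of AA(m) may be $\|W\|$ for certain matrices $W$ and specific initial estimates $x^{(0)}$.
   Context: $\|\cdot\|$ is the Euclidean norm on vectors and the spectral (operator) norm on matrices; $\lambda_{\max}(W),\lambda_{\min}(W)$ are the largest and smallest eigenvalues of $W$. Windowed Anderson acceleration of depth $m$, AA(m), applied to $q:\mathbb{R}^n\to\mathbb{R}^n$ from $x^{(0)}\in\mathbb{R}^n$: set $x^{(1)}=q(x^{(0)})$. For $k=1,2,\dots$, let $m_k=\min(m,k)$, let $(\alpha^{(k)}_j)_{j=k-m_k}^{k}$ be real numbers minimizing $\big\|\sum_{j=k-m_k}^{k}\alpha_j\,(q(x^{(j)})-x^{(j)})\big\|$ subject to $\sum_{j=k-m_k}^{k}\alpha_j=1$, and set $x^{(k+1)}=\sum_{j=k-m_k}^{k}\alpha^{(k)}_j\,q(x^{(j)})$. For a sequence $\{x^{(k)}\}$ converging to $x_*$ (here the unique fixed point of $q$), its $r$-linear convergence factor is $\limsup_{k\to\infty}\|x_*-x^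{(k)}\|^{1/k}$.
   Formalization: The strict inequality is stated for W ≠ 0, since for W = 0 and m ≥ 2 it would read 0 < 0; the final example for m = 1 is given with W ≠ 0 in every dimension n ≥ 2. The factor of a method is taken as the supremum over all initial estimates. *)

theory Defs
  imports "HOL-Analysis.Analysis"
begin

definition eigenvalues :: "real^'n^'n \<Rightarrow> real set" where
  "eigenvalues W = {l. \<exists>v. v \<noteq> 0 \<and> W *v v = l *\<^sub>R v}"

text \<open>
  The set of eigenvalues is finite, and it is nonempty for symmetric \<open>W\<close>, so
  \<^const>\<open>Max\<close> and \<^const>\<open>Min\<close> are meaningful on it.
\<close>

definition lambda_max :: "real^'n^'n \<Rightarrow> real" where
  "lambda_max W = Max (eigenvalues W)"

definition lambda_min :: "real^'n^'n \<Rightarrow> real" where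
  "lambda_min W = Min (eigenvalues W)"

definition spectral_norm :: "real^'n^'n \<Rightarrow> real" where
  "spectral_norm W = onorm ((*v) W)"

text \<open>
  The coefficients \<open>\<alpha>\<close> are a function on all of \<^typ>\<open>nat\<close>; only its values on the window
  \<open>{k - min m k..k}\<close> matter. Minimizers need not be unique, so this is a relation between
  the initial estimate and the sequence of iterates.
\<close>

definition anderson ::
  "nat \<Rightarrow> (real^'n \<Rightarrow> real^'n) \<Rightarrow> real^'n \<Rightarrow> (nat \<Rightarrow> real^'n) \<Rightarrow> bool" where
  "anderson m q x0 x \<longleftrightarrow>
     x 0 = x0 \<and> x 1 = q x0 \<and>
     (\<forall>k\<ge>1. \<exists>\<alpha>::nat \<Rightarrow> real.
        is_arg_min
          (\<lambda>\<alpha>. norm (\<Sum>j = k - min m k..k. \<alpha> j *\<^sub>R (q (x j) - x j)))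
          (\<lambda>\<alpha>. (\<Sum>j = k - min m k..k. \<alpha> j) = 1) \<alpha> \<and>
        x (Suc k) = (\<Sum>j = k - min m k..k. \<alpha> j *\<^sub>R q (x j)))"

text \<open>The value is meaningful only if \<open>q\<close> has exactly one fixed point.\<close>

definition fixpoint :: "(real^'n \<Rightarrow> real^'n) \<Rightarrow> real^'n" where
  "fixpoint q = (THE z. q z = z)"

lemma affine_ex1_fixpoint:
  fixes W :: "real^'n^'n"
  assumes "spectral_norm W < 1"
  shows "\<exists>!z. W *v z + a = z"
proof (rule banach_fix_type)
  show "0 \<le> spectral_norm W"
    unfolding spectral_norm_def by (simp add: onorm_pos_le)
  have "dist (W *v x + a) (W *v y + a) \<le> spectral_norm W * dist x y" for x y
    using onorm[of "(*v) W" "x - y"]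
    by (simp add: spectral_norm_def dist_norm matrix_vector_mult_diff_distrib)
  then show "\<forall>x y. dist (W *v x + a) (W *v y + a) \<le> spectral_norm W * dist x y"
    by blast
qed (fact assms)

definition seq_factor :: "real^'n \<Rightarrow> (nat \<Rightarrow> real^'n) \<Rightarrow> ereal" where
  "seq_factor z x = limsup (\<lambda>k. ereal (norm (z - x k) powr (1 / real k)))"

text \<open>
  The factor of a method is the worst case over all initial estimates and all sequences
  that the method can generate from them.
\<close>

definition anderson_factor :: "nat \<Rightarrow> (real^'n \<Rightarrow> real^'n) \<Rightarrow> ereal" where
  "anderson_factor m q = Sup {seq_factor (fixpoint q) x | x0 x. anderson m q x0 x}"

definition fixpoint_iteration_factor :: "(real^'n \<Rightarrow> real^'n) \<Rightarrow> ereal" where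
  "fixpoint_iteration_factor q = (SUP x0. seq_factor (fixpoint q) (\<lambda>k. (q ^^ k) x0))"

end

theory Submission
  imports Defs
begin

text \<open>
  The residuals \<open>r\<^sub>k = q(x\<^sub>k) - x\<^sub>k\<close> satisfy \<open>r\<^sub>k\<^sub>+\<^sub>1 = W s\<^sub>k\<close>, where \<open>s\<^sub>k\<close> is the point of least norm in
  the affine hull of the residuals in the window, that is \<open>s\<^sub>k \<bullet> r\<^sub>j = s\<^sub>k \<bullet> s\<^sub>k\<close> for every \<open>j\<close> in
  the window. With \<open>\<rho> = \<parallel>W\<parallel>\<close>, each step thus contracts the residual at least by \<open>\<rho>\<close>.
  If three consecutive steps contract it by exactly \<open>\<rho>\<^sup>3\<close>, then \<open>s\<^sub>k = r\<^sub>k\<close> throughout and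
  \<open>W\<^sup>2 r\<^sub>k = \<rho>\<^sup>2 r\<^sub>k\<close>. For \<open>m \<ge> 2\<close> the window then contains the distinct parallel vectors
  \<open>r\<^sub>k\<close> and \<open>r\<^sub>k\<^sub>+\<^sub>2 = \<rho>\<^sup>2 r\<^sub>k\<close>, a contradiction; for \<open>m = 1\<close> orthogonality gives
  \<open>W r\<^sub>k \<bullet> r\<^sub>k = \<rho>\<^sup>2 (r\<^sub>k \<bullet> r\<^sub>k)\<close>, so \<open>r\<^sub>k\<close> has components for both \<open>\<rho>\<close> and \<open>-\<rho>\<close>.
  By compactness, the contraction over three steps is uniformly stronger than \<open>\<rho>\<^sup>3\<close>.
  When \<open>\<rho>\<close> and \<open>-\<rho>\<close> are both eigenvalues, an initial residual combining them in the right
  proportion makes AA(1) coincide with the fixed-point iteration.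
\<close>

subsection \<open>Symmetric matrices\<close>

lemma norm_mult_vec_le_spectral_norm:
  fixes W :: "real^'n^'n"
  shows "norm (W *v x) \<le> spectral_norm W * norm x"
  unfolding spectral_norm_def by (rule onorm) simp

lemma spectral_norm_nonneg: "0 \<le> spectral_norm W"
  unfolding spectral_norm_def by (simp add: onorm_pos_le)

lemma spectral_norm_pos:
  fixes W :: "real^'n^'n"
  assumes "W \<noteq> 0"
  shows "0 < spectral_norm W"
proof -
  have "spectral_norm W \<noteq> 0"
  proof
    assume "spectral_norm W = 0"
    then have "\<forall>x. W *v x = 0"
      using norm_mult_vec_le_spectral_norm[of W] by simp
    then have "W = 0"
      by (simp add: matrix_eq)
    with assms show False ..
  qed
  then show ?thesis
    using spectral_norm_nonneg[of W] by simp
qed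

lemma symmetric_inner:
  fixes W :: "real^'n^'n"
  assumes "transpose W = W"
  shows "(W *v x) \<bullet> y = x \<bullet> (W *v y)"
  by (metis assms dot_lmul_matrix transpose_matrix_vector)

lemma spectral_norm_attained:
  fixes W :: "real^'n^'n"
  obtains v where "norm v = 1" "norm (W *v v) = spectral_norm W"
proof -
  have "continuous_on (sphere 0 1) (\<lambda>x. norm (W *v x))"
    by (intro continuous_intros linear_continuous_on) simp
  moreover have "sphere (0 :: real^'n) 1 \<noteq> {}"
    by simp
  ultimately obtain v where v: "norm v = 1"
    and max: "\<And>y. norm y = 1 \<Longrightarrow> norm (W *v y) \<le> norm (W *v v)"
    using continuous_attains_sup[of "sphere (0 :: real^'n) 1" "\<lambda>x. norm (W *v x)"] by auto
  have "norm (W *v x) \<le> norm (W *v v) * norm x" for x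
  proof (cases "x = 0")
    case False
    then have "norm (W *v (inverse (norm x) *\<^sub>R x)) \<le> norm (W *v v)"
      by (intro max) simp
    with False show ?thesis
      by (simp add: matrix_vector_mult_scaleR divide_simps)
  qed simp
  then have "spectral_norm W \<le> norm (W *v v)"
    unfolding spectral_norm_def by (intro onorm_le)
  with norm_mult_vec_le_spectral_norm[of W v] v have "norm (W *v v) = spectral_norm W"
    by simp
  with v that show thesis by blast
qed

text \<open>With p the norm of \<open>W\<close>, expand the squared norm of W^2 y - p^2 y: by
  symmetry the cross term is -2 p^4 |y|^2, and the two squares are at most p^4 |y|^2 each.\<close>

lemma symmetric_square_of_norm_eq:
  fixes W :: "real^'n^'n"
  assumes sym: "transpose W = W" and eq: "norm (W *v y) = spectral_norm W * norm y"
  shows "W *v (W *v y) = (spectral_norm W)\<^sup>2 *\<^sub>R y"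
proof -
  let ?p = "spectral_norm W" and ?z = "W *v (W *v y)"
  have "norm ?z \<le> ?p * norm (W *v y)"
    by (rule norm_mult_vec_le_spectral_norm)
  then have "norm ?z \<le> ?p\<^sup>2 * norm y"
    by (simp add: eq power2_eq_square)
  then have "(norm ?z)\<^sup>2 \<le> (?p\<^sup>2 * norm y)\<^sup>2"
    by (intro power_mono) auto
  moreover have "?z \<bullet> y = (?p * norm y)\<^sup>2"
    using symmetric_inner[OF sym, of "W *v y" y] by (simp flip: eq power2_norm_eq_inner)
  moreover have "(norm (?z - ?p\<^sup>2 *\<^sub>R y))\<^sup>2
      = (norm ?z)\<^sup>2 - 2 * ?p\<^sup>2 * (?z \<bullet> y) + ?p ^ 4 * (norm y)\<^sup>2"
    unfolding power2_norm_eq_inner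
    by (simp add: inner_commute algebra_simps power4_eq_xxxx
        power2_eq_square)
  ultimately have "(norm (?z - ?p\<^sup>2 *\<^sub>R y))\<^sup>2 \<le> 0"
    by (simp add: power_mult_distrib power4_eq_xxxx power2_eq_square algebra_simps)
  then show ?thesis by simp
qed

lemma eigenvalue_abs_le:
  fixes W :: "real^'n^'n"
  assumes "l \<in> eigenvalues W"
  shows "\<bar>l\<bar> \<le> spectral_norm W"
proof -
  obtain v where "v \<noteq> 0" "W *v v = l *\<^sub>R v"
    using assms by (auto simp: eigenvalues_def)
  then show ?thesis
    using norm_mult_vec_le_spectral_norm[of W v] by simp
qed

text \<open>Eigenvectors for distinct eigenvalues are orthogonal, hence independent.\<close>

lemma finite_eigenvalues:
  fixes W :: "real^'n^'n"
  assumes sym: "transpose W = W"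
  shows "finite (eigenvalues W)"
proof -
  have "\<forall>l\<in>eigenvalues W. \<exists>v. v \<noteq> 0 \<and> W *v v = l *\<^sub>R v"
    by (simp add: eigenvalues_def)
  then obtain f where f: "\<And>l. l \<in> eigenvalues W \<Longrightarrow> f l \<noteq> 0 \<and> W *v f l = l *\<^sub>R f l"
    by metis
  have orth: "f l \<bullet> f l' = 0"
    if "l \<in> eigenvalues W" "l' \<in> eigenvalues W" "l \<noteq> l'" for l l'
  proof -
    have "l * (f l \<bullet> f l') = l' * (f l \<bullet> f l')"
      using symmetric_inner[OF sym, of "f l" "f l'"] f that by simp
    with that show ?thesis by simp
  qed
  have inj: "inj_on f (eigenvalues W)"
    using f orth by (metis inj_onI inner_eq_zero_iff)
  have "pairwise orthogonal (f ` eigenvalues W)"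
    using orth by (auto simp: pairwise_def orthogonal_def)
  moreover have "0 \<notin> f ` eigenvalues W"
    using f by force
  ultimately have "finite (f ` eigenvalues W)"
    using pairwise_orthogonal_independent independent_imp_finite by blast
  with inj show ?thesis
    using finite_imageD by blast
qed

lemma lambda_max_eq_spectral_norm:
  fixes W :: "real^'n^'n"
  assumes "transpose W = W" "spectral_norm W \<in> eigenvalues W"
  shows "lambda_max W = spectral_norm W"
  unfolding lambda_max_def
  using assms eigenvalue_abs_le by (intro Max_eqI finite_eigenvalues) fastforce+

lemma lambda_min_eq_minus_spectral_norm:
  fixes W :: "real^'n^'n"
  assumes "transpose W = W" "- spectral_norm W \<in> eigenvalues W"
  shows "lambda_min W = - spectral_norm W"
  unfolding lambda_min_def
  using assms eigenvalue_abs_le by (intro Min_eqI finite_eigenvalues) fastforce+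

text \<open>Factor W^2 - p^2 = (W - p)(W + p): the vector (W + p) y is nonzero and W - p kills it.
  The sign of \<open>p\<close> is free, so both square roots are covered.\<close>

lemma eigenvalue_of_square_eigenvector:
  fixes W :: "real^'n^'n"
  assumes sq: "W *v (W *v y) = p\<^sup>2 *\<^sub>R y" and ne: "W *v y \<noteq> - p *\<^sub>R y"
  shows "p \<in> eigenvalues W"
proof -
  have "W *v (W *v y + p *\<^sub>R y) = p *\<^sub>R (W *v y + p *\<^sub>R y)"
    by (simp add: matrix_vector_right_distrib matrix_vector_mult_scaleR sq power2_eq_square
        algebra_simps)
  moreover have "W *v y + p *\<^sub>R y \<noteq> 0"
    using ne by (simp add: add_eq_0_iff2)
  ultimately show ?thesis
    by (auto simp: eigenvalues_def)
qed

subsection \<open>Three-step contraction\<close>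

lemma norm_le_of_inner_eq:
  fixes s y :: "'a::real_inner"
  assumes "s \<bullet> y = s \<bullet> s"
  shows "norm s \<le> norm y"
proof -
  have "(norm s)\<^sup>2 \<le> norm s * norm y"
    using norm_cauchy_schwarz[of s y] assms by (simp add: power2_norm_eq_inner)
  then show ?thesis
    by (cases "s = 0") (auto simp: power2_eq_square)
qed

lemma eq_of_inner_eq:
  fixes s y :: "'a::real_inner"
  assumes "s \<bullet> y = s \<bullet> s" "norm s = norm y"
  shows "s = y"
proof -
  have "y \<bullet> y = s \<bullet> s"
    using assms(2) by (simp add: norm_eq)
  then have "(s - y) \<bullet> (s - y) = 0"
    using assms(1) by (simp add: inner_diff_left inner_diff_right inner_commute)
  then show ?thesis by simp
qed

text \<open>Here \<open>y\<close>, \<open>W *v s0\<close>, \<open>W *v s1\<close>,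
  \<open>W *v s2\<close> stand for four consecutive residuals and \<open>s0\<close>,
  \<open>s1\<close>, \<open>s2\<close> for the least-norm points between them. Only orthogonality
  relations for residuals sure to lie in the window are kept.\<close>

lemma three_steps_strict:
  fixes W :: "real^'n^'n" and m :: nat
  assumes sym: "transpose W = W" and p1: "spectral_norm W < 1" and W0: "W \<noteq> 0"
    and m: "2 \<le> m \<or> lambda_max W \<noteq> - lambda_min W" and y: "y \<noteq> 0"
    and s0: "s0 \<bullet> y = s0 \<bullet> s0"
    and s1: "s1 \<bullet> (W *v s0) = s1 \<bullet> s1" "s1 \<bullet> y = s1 \<bullet> s1"
    and s2: "s2 \<bullet> (W *v s1) = s2 \<bullet> s2" "2 \<le> m \<longrightarrow> s2 \<bullet> y = s2 \<bullet> s2"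
  shows "norm (W *v s2) < spectral_norm W ^ 3 * norm y"
proof (rule ccontr)
  let ?p = "spectral_norm W"
  assume "\<not> ?thesis"
  then have ge: "?p ^ 3 * norm y \<le> norm (W *v s2)" by simp
  note p0 = spectral_norm_pos[OF W0]
  have a: "norm (W *v x) \<le> ?p * norm x" for x
    by (rule norm_mult_vec_le_spectral_norm)
  have n0: "norm s0 \<le> norm y" and n1: "norm s1 \<le> norm (W *v s0)"
    and n2: "norm s2 \<le> norm (W *v s1)"
    using s0 s1 s2 by (auto intro: norm_le_of_inner_eq)
  \<comment> \<open>The contractions are read backwards: no slack in the product of three steps
    leaves none in any single step.\<close>
  have "?p * (?p\<^sup>2 * norm y) \<le> ?p * norm s2"
    using ge a[of s2] by (simp add: power2_eq_square power3_eq_cube mult.assoc)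
  then have l2: "?p * (?p * norm y) \<le> norm s2"
    using p0 by (simp add: power2_eq_square)
  then have "?p * (?p * norm y) \<le> ?p * norm s1"
    using n2 a[of s1] by linarith
  then have l1: "?p * norm y \<le> norm s1"
    using p0 by simp
  then have "?p * norm y \<le> ?p * norm s0"
    using n1 a[of s0] by linarith
  then have l0: "norm y \<le> norm s0"
    using p0 by simp
  have e0: "s0 = y"
    using l0 n0 by (intro eq_of_inner_eq[OF s0] antisym)
  have Wy: "norm (W *v y) = ?p * norm y"
    using a[of y] l1 n1 by (simp add: e0)
  have e1: "s1 = W *v y"
    using s1 l1 n1 Wy by (intro eq_of_inner_eq[OF s1(1)[unfolded e0]] antisym) (auto simp: e0)
  have sq: "W *v (W *v y) = ?p\<^sup>2 *\<^sub>R y"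
    using symmetric_square_of_norm_eq[OF sym Wy] .
  have e2: "s2 = ?p\<^sup>2 *\<^sub>R y"
    using s2(1) l2 n2 unfolding e1 sq
    by (intro eq_of_inner_eq[where y = "?p\<^sup>2 *\<^sub>R y"] antisym) (auto simp: power2_eq_square)
  show False
  proof (cases "2 \<le> m")
    case True
    \<comment> \<open>The window still contains \<open>y\<close>, so
      \<open>s2 \<bullet> y = s2 \<bullet> s2\<close> reads p^2 |y|^2 = p^4 |y|^2.\<close>
    with s2(2) e2 y p0 have "?p\<^sup>2 = ?p ^ 4" by simp
    moreover have "?p ^ 4 < ?p\<^sup>2"
      using p0 p1 by (intro power_strict_decreasing) auto
    ultimately show False by simp
  next
    case False
    \<comment> \<open>Otherwise \<open>s1 \<bullet> y = s1 \<bullet> s1\<close> would force l = l^2,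
      although 0 < |l| < 1.\<close>
    have ne: "W *v y \<noteq> l *\<^sub>R y" if "l = ?p \<or> l = - ?p" for l
    proof
      assume "W *v y = l *\<^sub>R y"
      with s1(2) e1 y have "l * 1 = l * l" by simp
      with that p0 p1 show False by auto
    qed
    have "?p \<in> eigenvalues W" "- ?p \<in> eigenvalues W"
      using eigenvalue_of_square_eigenvector[of W y ?p] eigenvalue_of_square_eigenvector[of W y "- ?p"] sq
        ne[of ?p] ne[of "- ?p"] by simp_all
    with False m sym show False
      using lambda_max_eq_spectral_norm lambda_min_eq_minus_spectral_norm by fastforce
  qed
qed

text \<open>
  The minimizers in the window depend discontinuously on the residuals, but the orthogonality
  relations they satisfy are closed; this is what makes a compactness argument possible.
\<close>

lemma three_steps_uniform:
  fixes W :: "real^'n^'n" and m :: nat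
  assumes sym: "transpose W = W" and p1: "spectral_norm W < 1" and W0: "W \<noteq> 0"
    and m: "2 \<le> m \<or> lambda_max W \<noteq> - lambda_min W"
  obtains c where "0 < c" "c < spectral_norm W ^ 3"
    "\<And>y s0 s1 s2. \<lbrakk>s0 \<bullet> y = s0 \<bullet> s0; s1 \<bullet> (W *v s0) = s1 \<bullet> s1; s1 \<bullet> y = s1 \<bullet> s1;
        s2 \<bullet> (W *v s1) = s2 \<bullet> s2; 2 \<le> m \<longrightarrow> s2 \<bullet> y = s2 \<bullet> s2\<rbrakk>
      \<Longrightarrow> norm (W *v s2) \<le> c * norm y"
proof -
  let ?p = "spectral_norm W"
  define P where "P y s0 s1 s2 \<longleftrightarrow> s0 \<bullet> y = s0 \<bullet> s0 \<and> s1 \<bullet> (W *v s0) = s1 \<bullet> s1 \<and>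
    s1 \<bullet> y = s1 \<bullet> s1 \<and> s2 \<bullet> (W *v s1) = s2 \<bullet> s2 \<and> (2 \<le> m \<longrightarrow> s2 \<bullet> y = s2 \<bullet> s2)"
    for y s0 s1 s2 :: "real^'n"
  \<comment> \<open>Normalising \<open>y\<close> bounds \<open>s0\<close>, \<open>s1\<close>,
    \<open>s2\<close> as well, so this closed set is compact.\<close>
  define K where "K = {(y, s0, s1, s2). norm y = 1 \<and> P y s0 s1 s2}"
  have bound: "norm s0 \<le> norm y \<and> norm s1 \<le> norm y \<and> norm s2 \<le> norm y"
    if "P y s0 s1 s2" for y s0 s1 s2
  proof -
    have a: "norm (W *v x) \<le> norm x" for x
      using norm_mult_vec_le_spectral_norm[of W x] mult_right_mono[of ?p 1 "norm x"] p1 by simp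
    have "norm s0 \<le> norm y" "norm s1 \<le> norm y" "norm s2 \<le> norm (W *v s1)"
      using that by (auto simp: P_def intro: norm_le_of_inner_eq)
    with a[of s1] show ?thesis by simp
  qed
  have cl: "closed K"
  proof -
    have "K = {t. norm (fst t) = 1 \<and> P (fst t) (fst (snd t)) (fst (snd (snd t))) (snd (snd (snd t)))}"
      by (auto simp: K_def)
    also have "closed \<dots>"
      unfolding P_def
      by (intro closed_Collect_conj closed_Collect_imp closed_Collect_eq open_Collect_const
          continuous_intros linear_continuous_on_compose[where g = "(*v) W"]) auto
    finally show ?thesis .
  qed
  have "K \<subseteq> cball 0 1 \<times> cball 0 1 \<times> cball 0 1 \<times> cball 0 1"
    using bound by (fastforce simp: K_def)
  then have "bounded K"
    by (rule bounded_subset[rotated]) (intro bounded_Times bounded_cball)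
  with cl have comp: "compact K"
    by (simp add: compact_eq_bounded_closed)
  let ?f = "\<lambda>t. norm (W *v snd (snd (snd t)))"
  have cont: "continuous_on K ?f"
    by (intro continuous_intros linear_continuous_on_compose[where g = "(*v) W"]) auto
  have strict: "?f t < ?p ^ 3" if "t \<in> K" for t
  proof -
    obtain y s0 s1 s2 where t: "t = (y, s0, s1, s2)" by (cases t)
    with that have "norm y = 1" "P y s0 s1 s2" by (auto simp: K_def)
    moreover from this have "y \<noteq> 0" by auto
    ultimately show ?thesis
      using three_steps_strict[OF sym p1 W0 m, of y s0 s1 s2] by (simp add: P_def t)
  qed
  obtain c0 where c0: "c0 < ?p ^ 3" "\<And>t. t \<in> K \<Longrightarrow> ?f t \<le> c0"
  proof (cases "K = {}")
    case True
    then show thesis using that[of 0] spectral_norm_pos[OF W0] by simp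
  next
    case False
    then show thesis
      using continuous_attains_sup[OF comp _ cont] strict that by metis
  qed
  \<comment> \<open>The maximum keeps \<open>c\<close> positive, so that its cube root can serve as
    a positive rate.\<close>
  define c where "c = max c0 (?p ^ 3 / 2)"
  have c: "0 < c" "c < ?p ^ 3"
    using c0(1) spectral_norm_pos[OF W0] by (auto simp: c_def less_max_iff_disj)
  have "norm (W *v s2) \<le> c * norm y" if P: "P y s0 s1 s2" for y s0 s1 s2
  proof (cases "y = 0")
    case True
    then show ?thesis using bound[OF P] by simp
  next
    case False
    \<comment> \<open>The relations in \<open>P\<close> are homogeneous of degree two, hence survive
      rescaling to unit \<open>y\<close>.\<close>
    let ?i = "inverse (norm y)"
    have "(?i *\<^sub>R y, ?i *\<^sub>R s0, ?i *\<^sub>R s1, ?i *\<^sub>R s2) \<in> K"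
      using P False by (auto simp: K_def P_def matrix_vector_mult_scaleR)
    from c0(2)[OF this] have "?i * norm (W *v s2) \<le> c"
      by (simp add: c_def matrix_vector_mult_scaleR)
    with False show ?thesis
      by (simp add: field_simps)
  qed
  with c show thesis
    using that unfolding P_def by blast
qed

subsection \<open>Convergence factors\<close>

lemma geometric_powr_inverse_tendsto:
  fixes C g :: real
  assumes "0 < C" "0 \<le> g"
  shows "(\<lambda>k. (C * g ^ k) powr (1 / real k)) \<longlonglongrightarrow> g"
proof -
  have "(\<lambda>k. 1 / real k) \<longlonglongrightarrow> 0"
    by (rule lim_1_over_n)
  then have "(\<lambda>k. C powr (1 / real k) * g) \<longlonglongrightarrow> C powr 0 * g"
    using assms by (intro tendsto_intros) auto
  \<comment> \<open>At \<open>k = 0\<close> division by zero makes the exponent 0, so the identity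
    is only claimed eventually.\<close>
  moreover have "\<forall>\<^sub>F k in sequentially. C powr (1 / real k) * g = (C * g ^ k) powr (1 / real k)"
    using eventually_gt_at_top[of 0]
  proof eventually_elim
    case (elim k)
    have "(g ^ k) powr (1 / real k) = g"
      using elim assms root_powr_inverse[of k "g ^ k"] by (simp add: real_root_power_cancel)
    with assms show ?case by (simp add: powr_mult)
  qed
  ultimately show ?thesis
    using assms by (auto intro: Lim_transform_eventually)
qed

lemma seq_factor_geometric:
  assumes "0 < C" "0 \<le> g" "\<And>k. norm (z - x k) = C * g ^ k"
  shows "seq_factor z x = ereal g"
  unfolding seq_factor_def using geometric_powr_inverse_tendsto[OF assms(1,2)] assms(3)
  by (intro lim_imp_Limsup) auto

lemma seq_factor_le:
  assumes "0 < C" "0 \<le> g" "\<And>k. norm (z - x k) \<le> C * g ^ k"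
  shows "seq_factor z x \<le> ereal g"
proof -
  have "seq_factor z x \<le> limsup (\<lambda>k. ereal ((C * g ^ k) powr (1 / real k)))"
    unfolding seq_factor_def using assms(3)
    by (intro Limsup_mono always_eventually allI) (auto intro: powr_mono2)
  also have "\<dots> = ereal g"
    using geometric_powr_inverse_tendsto[OF assms(1,2)] by (intro lim_imp_Limsup) auto
  finally show ?thesis .
qed

lemma fixpoint_affine:
  fixes W :: "real^'n^'n"
  assumes "spectral_norm W < 1"
  shows "W *v fixpoint (\<lambda>x. W *v x + a) + a = fixpoint (\<lambda>x. W *v x + a)"
  using theI'[OF affine_ex1_fixpoint[OF assms]] unfolding fixpoint_def .

lemma affine_iterate:
  fixes W :: "real^'n^'n"
  assumes "W *v z + a = z"
  shows "((\<lambda>x. W *v x + a) ^^ k) x = z + ((*v) W ^^ k) (x - z)"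
proof (induction k)
  case (Suc k)
  then show ?case
    using assms by (simp add: matrix_vector_right_distrib algebra_simps)
qed simp

lemma norm_iterate_le:
  fixes W :: "real^'n^'n"
  shows "norm (((*v) W ^^ k) v) \<le> spectral_norm W ^ k * norm v"
proof (induction k)
  case (Suc k)
  have "norm (((*v) W ^^ Suc k) v) \<le> spectral_norm W * norm (((*v) W ^^ k) v)"
    using norm_mult_vec_le_spectral_norm by simp
  also have "\<dots> \<le> spectral_norm W * (spectral_norm W ^ k * norm v)"
    using Suc spectral_norm_nonneg by (intro mult_left_mono)
  finally show ?case by (simp add: mult.assoc)
qed simp

text \<open>Even powers of \<open>W\<close> act on \<open>v\<close> as powers of p^2, which allows
  induction in steps of two.\<close>

lemma norm_iterate_eq:
  fixes W :: "real^'n^'n"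
  assumes sq: "W *v (W *v v) = p\<^sup>2 *\<^sub>R v" and eq: "norm (W *v v) = p * norm v"
  shows "norm (((*v) W ^^ k) v) = p ^ k * norm v"
proof (induction k rule: induct_nat_012)
  case (ge2 k)
  have "((*v) W ^^ Suc (Suc k)) v = p\<^sup>2 *\<^sub>R ((*v) W ^^ k) v"
  proof (induction k)
    case (Suc k)
    then show ?case by (simp add: matrix_vector_mult_scaleR)
  qed (simp add: sq)
  then show ?case
    using ge2(1) by (simp add: power2_eq_square mult.assoc)
qed (use eq in auto)

lemma fixpoint_iteration_factor_affine:
  fixes W :: "real^'n^'n"
  assumes sym: "transpose W = W" and p1: "spectral_norm W < 1"
  shows "fixpoint_iteration_factor (\<lambda>x. W *v x + a) = ereal (spectral_norm W)"
proof -
  let ?q = "\<lambda>x. W *v x + a" and ?p = "spectral_norm W"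
  define z where "z = fixpoint ?q"
  have z: "W *v z + a = z"
    unfolding z_def by (rule fixpoint_affine[OF p1])
  have err: "norm (z - (?q ^^ k) x) = norm (((*v) W ^^ k) (x - z))" for k x
    by (simp add: affine_iterate[OF z])
  show ?thesis
    unfolding fixpoint_iteration_factor_def z_def[symmetric]
  proof (rule antisym)
    show "(SUP x0. seq_factor z (\<lambda>k. (?q ^^ k) x0)) \<le> ereal ?p"
    proof (rule SUP_least)
      fix x0
      have "norm (z - (?q ^^ k) x0) \<le> (norm (x0 - z) + 1) * ?p ^ k" for k
        unfolding err using norm_iterate_le[of k W "x0 - z"] spectral_norm_nonneg[of W]
        by (simp add: distrib_left mult.commute add_increasing2)
      then show "seq_factor z (\<lambda>k. (?q ^^ k) x0) \<le> ereal ?p"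
        by (intro seq_factor_le[where C = "norm (x0 - z) + 1"])
          (auto simp: spectral_norm_nonneg add_nonneg_pos)
    qed
    \<comment> \<open>A vector attaining the norm is an eigenvector of W^2, so the error started at
      \<open>v\<close> shrinks by exactly \<open>?p\<close> in every step.\<close>
    obtain v where v: "norm v = 1" "norm (W *v v) = ?p"
      by (rule spectral_norm_attained)
    have "W *v (W *v v) = ?p\<^sup>2 *\<^sub>R v"
      using v by (intro symmetric_square_of_norm_eq[OF sym]) simp
    then have "norm (((*v) W ^^ k) v) = ?p ^ k" for k
      using norm_iterate_eq[of W v ?p k] v by simp
    then have "seq_factor z (\<lambda>k. (?q ^^ k) (z + v)) = ereal ?p"
      using spectral_norm_nonneg by (intro seq_factor_geometric[where C = 1]) (auto simp: err)
    then show "ereal ?p \<le> (SUP x0. seq_factor z (\<lambda>k. (?q ^^ k) x0))"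
      by (metis SUP_upper UNIV_I)
  qed
qed

subsection \<open>Anderson acceleration\<close>

text \<open>First-order optimality: moving from the minimizer towards any \<open>r i\<close> stays
  in the affine hull, so the norm cannot decrease in that direction or its opposite.\<close>

lemma inner_eq_of_arg_min:
  fixes r :: "nat \<Rightarrow> 'a::real_inner"
  assumes min: "is_arg_min (\<lambda>\<alpha>. norm (\<Sum>j\<in>S. \<alpha> j *\<^sub>R r j)) (\<lambda>\<alpha>. (\<Sum>j\<in>S. \<alpha> j) = 1) \<alpha>"
    and S: "finite S" "i \<in> S"
  shows "(\<Sum>j\<in>S. \<alpha> j *\<^sub>R r j) \<bullet> r i = (\<Sum>j\<in>S. \<alpha> j *\<^sub>R r j) \<bullet> (\<Sum>j\<in>S. \<alpha> j *\<^sub>R r j)"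
proof -
  define s where "s = (\<Sum>j\<in>S. \<alpha> j *\<^sub>R r j)"
  define d where "d = r i - s"
  have one: "(\<Sum>j\<in>S. \<alpha> j) = 1"
    using min by (simp add: is_arg_min_def)
  have le: "norm s \<le> norm (s + t *\<^sub>R d)" for t
  proof -
    define \<beta> where "\<beta> j = (1 - t) * \<alpha> j + t * of_bool (j = i)" for j
    have "(\<Sum>j\<in>S. \<beta> j) = 1"
      using S by (simp add: \<beta>_def sum.distrib one flip: sum_distrib_left)
    moreover have "(\<Sum>j\<in>S. \<beta> j *\<^sub>R r j) = s + t *\<^sub>R d"
    proof -
      have "(\<Sum>j\<in>S. \<beta> j *\<^sub>R r j)
          = (1 - t) *\<^sub>R s + t *\<^sub>R (\<Sum>j\<in>S. of_bool (j = i) *\<^sub>R r j)"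
        by (simp add: \<beta>_def s_def scaleR_add_left sum.distrib scaleR_sum_right)
      also have "(\<Sum>j\<in>S. of_bool (j = i) *\<^sub>R r j) = (\<Sum>j\<in>S. if j = i then r j else 0)"
        by (intro sum.cong) auto
      also have "\<dots> = r i"
        using S by simp
      finally show ?thesis
        by (simp add: d_def algebra_simps)
    qed
    ultimately show ?thesis
      using min unfolding is_arg_min_def s_def by (metis not_less)
  qed
  have "s \<bullet> d = 0"
  proof (cases "d = 0")
    case False
    \<comment> \<open>This minimizes the quadratic in \<open>t\<close>; a nonzero
      \<open>s \<bullet> d\<close> would make its value smaller than at 0.\<close>
    define t where "t = - (s \<bullet> d) / (d \<bullet> d)"
    have "s \<bullet> s \<le> (s + t *\<^sub>R d) \<bullet> (s + t *\<^sub>R d)"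
      using le[of t] by (simp add: norm_le)
    also have "\<dots> = s \<bullet> s + 2 * t * (s \<bullet> d) + t * t * (d \<bullet> d)"
      by (simp add: inner_add_left inner_add_right inner_commute)
    also have "\<dots> = s \<bullet> s - (s \<bullet> d)\<^sup>2 / (d \<bullet> d)"
      using False by (simp add: t_def field_simps power2_eq_square)
    finally have "(s \<bullet> d)\<^sup>2 / (d \<bullet> d) \<le> 0" by simp
    moreover have "0 < d \<bullet> d"
      using False by simp
    ultimately have "(s \<bullet> d)\<^sup>2 \<le> 0 * (d \<bullet> d)"
      by (simp only: pos_divide_le_eq)
    then show ?thesis by simp
  qed simp
  then show ?thesis
    by (simp add: d_def s_def inner_diff_right)
qed

text \<open>The weights sum to one, so \<open>x (Suc k)\<close> is the image under the affine map of
  the averaged iterate. The averaged residual \<open>s\<close> is the difference of these two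
  points, and \<open>W\<close> maps it to the new residual.\<close>

lemma anderson_residual:
  fixes W :: "real^'n^'n"
  assumes "anderson m (\<lambda>x. W *v x + a) x0 x"
  defines "r \<equiv> \<lambda>k. W *v x k + a - x k"
  shows "\<exists>s. r (Suc k) = W *v s \<and> (\<forall>j\<in>{k - min m k..k}. s \<bullet> r j = s \<bullet> s)"
proof (cases "k = 0")
  \<comment> \<open>The plain first step fits the pattern with \<open>s = r 0\<close>, the window
    being \<open>{0}\<close>.\<close>
  case True
  have "x 1 = W *v x 0 + a"
    using assms(1) by (simp add: anderson_def)
  with True show ?thesis
    by (auto simp: r_def algebra_simps intro!: exI[of _ "r 0"])
next
  case False
  then have "1 \<le> k" by simp
  let ?S = "{k - min m k..k}"
  obtain \<alpha> where
    min: "is_arg_min (\<lambda>\<alpha>. norm (\<Sum>j\<in>?S. \<alpha> j *\<^sub>R r j)) (\<lambda>\<alpha>. (\<Sum>j\<in>?S. \<alpha> j) = 1) \<alpha>"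
    and x: "x (Suc k) = (\<Sum>j\<in>?S. \<alpha> j *\<^sub>R (W *v x j + a))"
    using assms(1) \<open>1 \<le> k\<close> unfolding anderson_def r_def by blast
  have one: "(\<Sum>j\<in>?S. \<alpha> j) = 1"
    using min by (simp add: is_arg_min_def)
  have "(\<Sum>j\<in>?S. \<alpha> j *\<^sub>R r j) = x (Suc k) - (\<Sum>j\<in>?S. \<alpha> j *\<^sub>R x j)"
    unfolding x r_def by (simp add: scaleR_diff_right sum_subtractf)
  moreover have "x (Suc k) = W *v (\<Sum>j\<in>?S. \<alpha> j *\<^sub>R x j) + a"
    unfolding x
    by (simp add: scaleR_add_right sum.distrib one matrix_vector_mult_scaleR
        linear_sum[OF matrix_vector_mul_linear] flip: scaleR_sum_left)
  moreover from this have "r (Suc k) = W *v x (Suc k) - W *v (\<Sum>j\<in>?S. \<alpha> j *\<^sub>R x j)"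
    by (simp add: r_def)
  ultimately have "r (Suc k) = W *v (\<Sum>j\<in>?S. \<alpha> j *\<^sub>R r j)"
    by (simp only: matrix_vector_mult_diff_distrib)
  with inner_eq_of_arg_min[OF min] show ?thesis
    by (intro exI[of _ "\<Sum>j\<in>?S. \<alpha> j *\<^sub>R r j"]) simp
qed

text \<open>Each residue class modulo 3 decays on its own; the constant dominates the three starting
  values.\<close>

lemma three_step_decay:
  fixes f :: "nat \<Rightarrow> real"
  assumes g: "0 < g" and f: "\<And>k. 0 \<le> f k" and step: "\<And>k. f (k + 3) \<le> g ^ 3 * f k"
  shows "f k \<le> (f 0 + f 1 / g + f 2 / g\<^sup>2) * g ^ k"
proof -
  define C where "C = f 0 + f 1 / g + f 2 / g\<^sup>2"
  have C: "f 0 \<le> C" "f 1 / g \<le> C" "f 2 / g\<^sup>2 \<le> C"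
    using g f by (auto simp: C_def add_increasing add_increasing2)
  have "f k \<le> C * g ^ k"
  proof (induction k rule: less_induct)
    case (less k)
    consider "k = 0" | "k = 1" | "k = 2" | j where "k = j + 3"
      by atomize_elim presburger
    then show ?case
    proof cases
      case (4 j)
      then have "g ^ 3 * f j \<le> g ^ 3 * (C * g ^ j)"
        using less[of j] g by (intro mult_left_mono) auto
      with 4 step[of j] show ?thesis
        by (simp add: power_add mult_ac)
    qed (use C g in \<open>auto simp: field_simps\<close>)
  qed
  then show ?thesis by (simp add: C_def)
qed

lemma anderson_factor_less:
  fixes W :: "real^'n^'n"
  assumes sym: "transpose W = W" and p1: "spectral_norm W < 1" and W0: "W \<noteq> 0" and m1: "1 \<le> m"
    and m: "2 \<le> m \<or> lambda_max W \<noteq> - lambda_min W"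
  shows "anderson_factor m (\<lambda>x. W *v x + a) < ereal (spectral_norm W)"
proof -
  let ?q = "\<lambda>x. W *v x + a" and ?p = "spectral_norm W"
  define z where "z = fixpoint ?q"
  have z: "W *v z + a = z"
    unfolding z_def by (rule fixpoint_affine[OF p1])
  obtain c where c: "0 < c" "c < ?p ^ 3"
    and contr: "\<And>y s0 s1 s2. \<lbrakk>s0 \<bullet> y = s0 \<bullet> s0; s1 \<bullet> (W *v s0) = s1 \<bullet> s1; s1 \<bullet> y = s1 \<bullet> s1;
        s2 \<bullet> (W *v s1) = s2 \<bullet> s2; 2 \<le> m \<longrightarrow> s2 \<bullet> y = s2 \<bullet> s2\<rbrakk>
      \<Longrightarrow> norm (W *v s2) \<le> c * norm y"
    by (rule three_steps_uniform[OF sym p1 W0 m]) blast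
  define g where "g = root 3 c"
  have g3: "g ^ 3 = c"
    by (simp add: g_def odd_real_root_pow)
  have g0: "0 < g"
    using c by (simp add: g_def)
  have gp: "g < ?p"
    using c(2) spectral_norm_nonneg[of W] by (intro power_less_imp_less_base[of g 3]) (auto simp: g3)
  have "seq_factor z x \<le> ereal g" if x: "anderson m ?q x0 x" for x0 x
  proof -
    define r where "r k = W *v x k + a - x k" for k
    have "\<forall>k. \<exists>s. r (Suc k) = W *v s \<and> (\<forall>j\<in>{k - min m k..k}. s \<bullet> r j = s \<bullet> s)"
      using anderson_residual[OF x] unfolding r_def by blast
    then obtain s where r: "\<And>k. r (Suc k) = W *v s k"
      and s: "\<And>k j. j \<in> {k - min m k..k} \<Longrightarrow> s k \<bullet> r j = s k \<bullet> s k"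
      by metis
    have step: "norm (r (k + 3)) \<le> g ^ 3 * norm (r k)" for k
    proof -
      have "norm (W *v s (Suc (Suc k))) \<le> c * norm (r k)"
      proof (rule contr[of "s k" _ "s (Suc k)"])
        show "s k \<bullet> r k = s k \<bullet> s k"
          by (rule s) simp
        show "s (Suc k) \<bullet> (W *v s k) = s (Suc k) \<bullet> s (Suc k)"
          unfolding r[symmetric] by (rule s) simp
        show "s (Suc k) \<bullet> r k = s (Suc k) \<bullet> s (Suc k)"
          using m1 by (intro s) auto
        show "s (Suc (Suc k)) \<bullet> (W *v s (Suc k)) = s (Suc (Suc k)) \<bullet> s (Suc (Suc k))"
          unfolding r[symmetric] by (rule s) simp
        \<comment> \<open>For \<open>m \<ge> 2\<close> the window two steps later still reaches back
          to \<open>k\<close>.\<close>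
        show "2 \<le> m \<longrightarrow> s (Suc (Suc k)) \<bullet> r k = s (Suc (Suc k)) \<bullet> s (Suc (Suc k))"
          by (intro impI s) auto
      qed
      then show ?thesis
        unfolding g3 by (simp add: r numeral_3_eq_3)
    qed
    define C where "C = norm (r 0) + norm (r 1) / g + norm (r 2) / g\<^sup>2"
    have C: "0 \<le> C"
      using g0 by (simp add: C_def)
    have decay: "norm (r k) \<le> C * g ^ k" for k
      using three_step_decay[of g "\<lambda>k. norm (r k)", OF g0 _ step] by (simp add: C_def)
    have "norm (z - x k) \<le> ((C + 1) / (1 - ?p)) * g ^ k" for k
    proof -
      \<comment> \<open>Residuals control errors: (I - W)(z - x_k) = r_k, and I - W shrinks norms at
        most by the factor \<open>1 - ?p\<close>.\<close>
      have "z - x k = W *v (z - x k) + r k"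
        using z by (simp add: r_def matrix_vector_mult_diff_distrib algebra_simps)
      then have "norm (z - x k) \<le> norm (W *v (z - x k)) + norm (r k)"
        by (metis norm_triangle_ineq)
      also have "\<dots> \<le> ?p * norm (z - x k) + (C + 1) * g ^ k"
        unfolding distrib_right
        using norm_mult_vec_le_spectral_norm[of W "z - x k"] decay[of k] zero_less_power[OF g0, of k]
        by linarith
      finally show ?thesis
        using p1 by (simp add: field_simps)
    qed
    then show ?thesis
      using C p1 g0 by (intro seq_factor_le[where C = "(C + 1) / (1 - ?p)"]) auto
  qed
  \<comment> \<open>The rate \<open>g\<close> is the same for all starts and all choices of
    minimizers, so strictness survives the supremum.\<close>
  then have "anderson_factor m ?q \<le> ereal g"
    unfolding anderson_factor_def z_def[symmetric] by (intro Sup_least) auto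
  with gp show ?thesis
    by (meson ereal_less(2) le_less_trans less_ereal.simps(1))
qed

section \<open>Depth one: an example without acceleration\<close>

text \<open>The optimal weights are always \<open>(0, 1)\<close>: AA(1) does not accelerate at all.\<close>

lemma anderson_1_unaccelerated:
  assumes orth: "\<And>k. (q ((q ^^ Suc k) x0) - (q ^^ Suc k) x0) \<bullet> (q ((q ^^ k) x0) - (q ^^ k) x0)
      = (norm (q ((q ^^ Suc k) x0) - (q ^^ Suc k) x0))\<^sup>2"
  shows "anderson 1 q x0 (\<lambda>k. (q ^^ k) x0)"
  unfolding anderson_def
proof (intro conjI allI impI)
  fix k :: nat
  assume "1 \<le> k"
  then obtain l where k: "k = Suc l"
    by (metis Suc_le_D One_nat_def)
  define r where "r j = q ((q ^^ j) x0) - (q ^^ j) x0" for j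
  have S: "{k - min 1 k..k} = {l, k}"
    by (auto simp: k)
  have ne: "l \<noteq> k" by (simp add: k)
  \<comment> \<open>Orthogonality makes \<open>r k\<close> the least-norm point of the affine hull
    of \<open>r l\<close> and \<open>r k\<close>.\<close>
  have min: "norm (r k) \<le> norm (\<beta> l *\<^sub>R r l + \<beta> k *\<^sub>R r k)" if "\<beta> l + \<beta> k = 1" for \<beta>
  proof -
    have b: "\<beta> k = 1 - \<beta> l" using that by simp
    have "r k \<bullet> (\<beta> l *\<^sub>R r l + \<beta> k *\<^sub>R r k) = r k \<bullet> r k"
      using orth[of l]
      by (simp add: r_def[symmetric] k[symmetric] b inner_add_right power2_norm_eq_inner algebra_simps)
    then show ?thesis
      by (metis norm_le_of_inner_eq)
  qed
  show "\<exists>\<alpha>. is_arg_min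
          (\<lambda>\<alpha>. norm (\<Sum>j = k - min 1 k..k. \<alpha> j *\<^sub>R (q ((q ^^ j) x0) - (q ^^ j) x0)))
          (\<lambda>\<alpha>. sum \<alpha> {k - min 1 k..k} = 1) \<alpha> \<and>
        (q ^^ Suc k) x0 = (\<Sum>j = k - min 1 k..k. \<alpha> j *\<^sub>R q ((q ^^ j) x0))"
    unfolding S r_def[symmetric]
  proof (intro exI[of _ "\<lambda>j. of_bool (j = k)"] conjI)
    show "is_arg_min (\<lambda>\<alpha>. norm (\<Sum>j\<in>{l, k}. \<alpha> j *\<^sub>R r j)) (\<lambda>\<alpha>. sum \<alpha> {l, k} = 1) (\<lambda>j. of_bool (j = k))"
      using ne min by (force simp: is_arg_min_def not_less)
  qed (use ne in simp)
qed auto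

text \<open>A diagonal matrix with entries 3/5 and a single -3/5 has W^2 = (9/25) I, so every plain
  iteration from a start other than the fixed point has factor exactly 3/5. It remains to choose a
  start for which AA(1) is that iteration.\<close>

lemma anderson_1_not_faster:
  assumes "2 \<le> CARD('n)"
  shows "\<exists>(W :: real^'n^'n) x0 x.
          transpose W = W \<and> spectral_norm W < 1 \<and> W \<noteq> 0 \<and>
          lambda_max W = - lambda_min W \<and>
          anderson 1 (\<lambda>x. W *v x + a) x0 x \<and>
          seq_factor (fixpoint (\<lambda>x. W *v x + a)) x = ereal (spectral_norm W)"
proof -
  obtain i j :: 'n where ij: "i \<noteq> j"
    using assms card_le_Suc0_iff_eq[of "UNIV :: 'n set"] by auto
  define W :: "real^'n^'n" where
    "W = (\<chi> k l. if k = l then (if k = j then -3/5 else 3/5) else 0)"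
  have Wv: "W *v v = (\<chi> k. (if k = j then -3/5 else 3/5) * v $ k)" for v
    by (simp add: W_def matrix_vector_mult_def vec_eq_iff if_distrib[of "\<lambda>x. x * _"] cong: if_cong)
  have sym: "transpose W = W"
    by (simp add: W_def transpose_def vec_eq_iff)
  have sq: "W *v (W *v v) = (3/5)\<^sup>2 *\<^sub>R v" for v
    by (simp add: Wv vec_eq_iff power2_eq_square)
  have nW: "norm (W *v v) = 3/5 * norm v" for v
  proof -
    have "(norm (W *v v))\<^sup>2 = (3/5 * norm v)\<^sup>2"
      unfolding power_mult_distrib power2_norm_eq_inner
      using symmetric_inner[OF sym, of v "W *v v"] sq[of v] by simp
    then show ?thesis by simp
  qed
  have p: "spectral_norm W = 3/5"
  proof -
    obtain v where "norm v = 1" "norm (W *v v) = spectral_norm W"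
      by (rule spectral_norm_attained)
    with nW[of v] show ?thesis by simp
  qed
  have ax: "W *v axis i 1 = (3/5) *\<^sub>R axis i 1" "W *v axis j 1 = (- (3/5)) *\<^sub>R axis j 1"
    using ij by (auto simp: Wv vec_eq_iff axis_def)
  then have "3/5 \<in> eigenvalues W" "- (3/5) \<in> eigenvalues W"
    unfolding eigenvalues_def
    by (auto intro: exI[of _ "axis i 1 :: real^'n"] exI[of _ "axis j 1 :: real^'n"] simp: axis_eq_0_iff)
  then have lam: "lambda_max W = - lambda_min W"
    using lambda_max_eq_spectral_norm[OF sym] lambda_min_eq_minus_spectral_norm[OF sym]
    by (simp add: p)
  let ?q = "\<lambda>x. W *v x + a"
  define z where "z = fixpoint ?q"
  have z: "W *v z + a = z"
    unfolding z_def using p by (intro fixpoint_affine) simp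
  \<comment> \<open>The first residual \<open>(W - I) v\<close> is \<open>R\<close>, whose components 2 and 1 are chosen
    so that \<open>(W R) \<bullet> R = (W R) \<bullet> (W R)\<close>.\<close>
  define v :: "real^'n" where "v = (-5) *\<^sub>R axis i 1 + (-5/8) *\<^sub>R axis j 1"
  define R :: "real^'n" where "R = 2 *\<^sub>R axis i 1 + axis j 1"
  have v0: "v \<noteq> 0"
    using ij by (auto simp: v_def vec_eq_iff axis_def intro!: exI[of _ i])
  have R: "W *v v - v = R"
    using ij by (auto simp: Wv v_def R_def vec_eq_iff axis_def)
  have WR: "(W *v R) \<bullet> R = (W *v R) \<bullet> (W *v R)"
    using ij by (simp add: R_def matrix_vector_right_distrib matrix_vector_mult_scaleR ax
        inner_add_left inner_add_right inner_diff_left inner_diff_right inner_axis_axis)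
  have res: "?q ((?q ^^ k) (z + v)) - (?q ^^ k) (z + v) = ((*v) W ^^ k) R" for k
  proof -
    have "((*v) W ^^ k) (W *v v - v) = W *v ((*v) W ^^ k) v - ((*v) W ^^ k) v"
      by (induction k) (auto simp: matrix_vector_mult_diff_distrib)
    then show ?thesis
      unfolding affine_iterate[OF z] using z by (simp add: R matrix_vector_right_distrib algebra_simps)
  qed
  \<comment> \<open>By symmetry and W^2 = (9/25) I, each step multiplies both sides by 9/25, so the
    relation for \<open>R\<close> propagates.\<close>
  have orth: "((*v) W ^^ Suc k) R \<bullet> ((*v) W ^^ k) R = (norm (((*v) W ^^ Suc k) R))\<^sup>2" for k
  proof (induction k)
    case 0
    then show ?case by (simp add: WR power2_norm_eq_inner)
  next
    case (Suc k)
    then show ?case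
      using symmetric_inner[OF sym, of "((*v) W ^^ Suc k) R" "((*v) W ^^ k) R"]
      by (simp add: nW sq power_mult_distrib power_divide inner_commute)
  qed
  have "anderson 1 ?q (z + v) (\<lambda>k. (?q ^^ k) (z + v))"
    using orth by (intro anderson_1_unaccelerated) (simp only: res)
  moreover have "seq_factor z (\<lambda>k. (?q ^^ k) (z + v)) = ereal (spectral_norm W)"
    using v0 norm_iterate_eq[OF sq nW]
    by (intro seq_factor_geometric[where C = "norm v"]) (auto simp: affine_iterate[OF z] p)
  moreover have "W \<noteq> 0"
    using p spectral_norm_pos nW[of v] v0 by auto
  ultimately show ?thesis
    using sym p lam unfolding z_def by (intro exI[of _ W] exI conjI) auto
qed

text \<open>For \<open>W = 0\<close> the norm is 0 and no factor, as a limsup of nonnegative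
  numbers, lies below it. In dimension one \<open>lambda_max W = - lambda_min W\<close> would force
  \<open>W = 0\<close>, hence the dimension bound in the last part.\<close>

theorem proposition3:
  fixes a :: "real^'n"
  shows
    "(\<forall>(W :: real^'n^'n) m :: nat.
        transpose W = W \<and> spectral_norm W < 1 \<and> W \<noteq> 0 \<and> 1 \<le> m \<and>
        (2 \<le> m \<or> lambda_max W \<noteq> - lambda_min W) \<longrightarrow>
          anderson_factor m (\<lambda>x. W *v x + a) < ereal (spectral_norm W)) \<and>
     (\<forall>W :: real^'n^'n.
        transpose W = W \<and> spectral_norm W < 1 \<longrightarrow>
          fixpoint_iteration_factor (\<lambda>x. W *v x + a) = ereal (spectral_norm W)) \<and>
     (2 \<le> CARD('n) \<longrightarrow>
        (\<exists>(W :: real^'n^'n) x0 x.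
          transpose W = W \<and> spectral_norm W < 1 \<and> W \<noteq> 0 \<and>
          lambda_max W = - lambda_min W \<and>
          anderson 1 (\<lambda>x. W *v x + a) x0 x \<and>
          seq_factor (fixpoint (\<lambda>x. W *v x + a)) x = ereal (spectral_norm W)))"
proof (intro conjI allI impI)
  fix W :: "real^'n^'n" and m :: nat
  assume "transpose W = W \<and> spectral_norm W < 1 \<and> W \<noteq> 0 \<and> 1 \<le> m \<and>
    (2 \<le> m \<or> lambda_max W \<noteq> - lambda_min W)"
  then show "anderson_factor m (\<lambda>x. W *v x + a) < ereal (spectral_norm W)"
    by (intro anderson_factor_less) auto
next
  fix W :: "real^'n^'n"
  assume "transpose W = W \<and> spectral_norm W < 1"
  then show "fixpoint_iteration_factor (\<lambda>x. W *v x + a) = ereal (spectral_norm W)"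
    by (intro fixpoint_iteration_factor_affine) auto
qed (rule anderson_1_not_faster)

end
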